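(* For each positive integer $m$ there is an integer $n_0$ such that for every odd integer $n \geq n_0$ there exists a perfect Latin rectangle of size $m \times n$.
   Context: Let $m\le n$ be positive integers. A Latin rectangle $R$ of size $m\times n$ is an $m\times n$ array filled with symbols from an alphabet $\Sigma_R$ of $n$ symbols such that each row contains every symbol of $\Sigma_R$ exactly once and each column contains $m$ distinct symbols; $R(a,c)$ denotes the symbol in row $a$, column $c$. For two rows $a,b$, the permutation $R_{a,b}$ of $\Sigma_R$ is defined by $R_{a,b}(x)=y$ iff there is a column $c$ with $R(a,c)=x$ and $R(b,c)=y$. The pair $(a,b)$ is perfect if $R_{a,b}$ is a cyclic permutation (a single cycle of length $n$), and $R$ is a perfect Latin rectangle if every pair of distinct rows is perfect. *)

theory Defs
  imports "HOL-Combinatorics.Combinatorics"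
begin

text \<open>
  Rows and columns are indexed by \<open>{..<m}\<close> and \<open>{..<n}\<close>; values of \<open>R\<close> outside this
  range are irrelevant.
\<close>
definition latin_rectangle :: "'a set \<Rightarrow> nat \<Rightarrow> nat \<Rightarrow> (nat \<Rightarrow> nat \<Rightarrow> 'a) \<Rightarrow> bool" where
  "latin_rectangle S m n R \<longleftrightarrow>
     1 \<le> m \<and> m \<le> n \<and> finite S \<and> card S = n \<and>
     (\<forall>a<m. bij_betw (\<lambda>c. R a c) {..<n} S) \<and>
     (\<forall>c<n. inj_on (\<lambda>a. R a c) {..<m})"

text \<open>
  The permutation \<open>R\<^bsub>a,b\<^esub>\<close> of \<open>S\<close>, extended by the identity outside \<open>S\<close>, as is
  customary for \<^const>\<open>permutes\<close>.
\<close>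
definition row_perm :: "'a set \<Rightarrow> nat \<Rightarrow> (nat \<Rightarrow> nat \<Rightarrow> 'a) \<Rightarrow> nat \<Rightarrow> nat \<Rightarrow> 'a \<Rightarrow> 'a" where
  "row_perm S n R a b x =
     (if x \<in> S then THE y. \<exists>c<n. R a c = x \<and> R b c = y else x)"

lemma row_perm_eq_iff:
  assumes "latin_rectangle S m n R" "a < m" "b < m" "x \<in> S"
  shows "row_perm S n R a b x = y \<longleftrightarrow> (\<exists>c<n. R a c = x \<and> R b c = y)"
proof -
  have bij: "bij_betw (\<lambda>c. R a c) {..<n} S"
    using assms by (auto simp: latin_rectangle_def)
  then obtain c where c: "c < n" "R a c = x"
    using \<open>x \<in> S\<close> by (auto simp: bij_betw_def)
  have uniq: "d = c" if "d < n" "R a d = x" for d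
    using bij c that by (auto simp: bij_betw_def inj_on_def)
  have "(THE y. \<exists>c<n. R a c = x \<and> R b c = y) = R b c"
    using c uniq by (intro the_equality) blast+
  then have "row_perm S n R a b x = R b c"
    using \<open>x \<in> S\<close> by (simp add: row_perm_def)
  then show ?thesis
    using c uniq by metis
qed

lemma row_perm_permutes:
  assumes R: "latin_rectangle S m n R" "a < m" "b < m"
  shows "row_perm S n R a b permutes S"
proof (rule bij_imp_permutes)
  have bij: "bij_betw (\<lambda>c. R i c) {..<n} S" if "i < m" for i
    using R that by (auto simp: latin_rectangle_def)
  have eq: "row_perm S n R a b (R a c) = R b c" if "c < n" for c
    using row_perm_eq_iff[OF R, of "R a c" "R b c"] bij_betwE[OF bij[OF \<open>a < m\<close>]] that by auto
  have "bij_betw (row_perm S n R a b \<circ> (\<lambda>c. R a c)) {..<n} S"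
    by (rule bij_betw_cong[THEN iffD2, OF _ bij[OF \<open>b < m\<close>]]) (simp add: eq)
  then show "bij_betw (row_perm S n R a b) S S"
    using bij_betw_comp_iff[OF bij[OF \<open>a < m\<close>]] by blast
qed (simp add: row_perm_def)

definition perfect_pair :: "'a set \<Rightarrow> nat \<Rightarrow> (nat \<Rightarrow> nat \<Rightarrow> 'a) \<Rightarrow> nat \<Rightarrow> nat \<Rightarrow> bool" where
  "perfect_pair S n R a b \<longleftrightarrow> cyclic_on (row_perm S n R a b) S"

definition perfect_latin_rectangle :: "'a set \<Rightarrow> nat \<Rightarrow> nat \<Rightarrow> (nat \<Rightarrow> nat \<Rightarrow> 'a) \<Rightarrow> bool" where
  "perfect_latin_rectangle S m n R \<longleftrightarrow>
     latin_rectangle S m n R \<and> (\<forall>a<m. \<forall>b<m. a \<noteq> b \<longrightarrow> perfect_pair S n R a b)"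

end

theory Submission
  imports Defs "HOL-Library.Sublist" "HOL-Number_Theory.Cong"
begin

text \<open>
  Start from the cyclic rectangle \<open>R(a,c) = a + c mod N\<close> where \<open>N \<equiv> 1\<close> modulo a fixed multiple
  \<open>M\<close> of \<open>1, \<dots>, m\<close>. For rows \<open>a < b\<close> the columns form a single cycle with step \<open>b - a\<close>, and
  since \<open>b - a\<close> divides \<open>M\<close> this cycle meets \<open>0, M, 2M, \<dots>\<close> in this order, whatever \<open>a, b\<close> are.
  Given such a rectangle with \<open>n\<close> columns and marked columns
  \<open>x\<^sub>0, y\<^sub>0, x\<^sub>1, y\<^sub>1, \<dots>, x\<^sub>m\<^sub>-\<^sub>1, y\<^sub>m\<^sub>-\<^sub>1, \<dots>\<close> that all the cycles meet in this order, add
  two columns and two symbols \<open>n, n + 1\<close>: in row \<open>a\<close> move the entries of columns \<open>x\<^sub>a, y\<^sub>a\<close> to the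
  new columns \<open>n, n + 1\<close> and replace them by the new symbols. As \<open>x\<^sub>a, x\<^sub>b\<close> and \<open>y\<^sub>a, y\<^sub>b\<close>
  interlace, each cycle stays a single cycle, and the marks not yet used keep their order.
  Repeating this adds any bounded even number to \<open>N\<close>.
\<close>

section \<open>Cyclic permutations given by lists\<close>

lemma funpow_rotate1:
  assumes "map f xs = rotate1 xs" "xs \<noteq> []"
  shows "(f ^^ k) (xs ! 0) = xs ! (k mod length xs)"
proof (induction k)
  case (Suc k)
  have lt: "k mod length xs < length xs"
    using assms(2) by simp
  have "f (xs ! (k mod length xs)) = rotate1 xs ! (k mod length xs)"
    using assms(1) lt by (metis nth_map)
  also have "\<dots> = xs ! (Suc k mod length xs)"
    using nth_rotate1[OF lt] by (simp add: mod_Suc_eq)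
  finally show ?case
    using Suc by simp
qed simp

lemma cyclic_on_rotate1:
  assumes "map f xs = rotate1 xs" "xs \<noteq> []"
  shows "cyclic_on f (set xs)"
proof (rule cyclic_on_singleI)
  show "xs ! 0 \<in> set xs"
    using assms(2) by simp
  show "set xs = orbit f (xs ! 0)"
  proof (intro equalityI subsetI)
    fix x assume "x \<in> set xs"
    then obtain i where i: "i < length xs" "x = xs ! i"
      by (auto simp: in_set_conv_nth)
    \<comment> \<open>\<open>orbit\<close> consists of positive powers only, so one full turn is
      added to cover \<open>i = 0\<close>.\<close>
    then have "x = (f ^^ (i + length xs)) (xs ! 0)"
      using funpow_rotate1[OF assms] by simp
    moreover have "0 < i + length xs"
      using assms(2) by simp
    ultimately show "x \<in> orbit f (xs ! 0)"
      unfolding orbit_altdef by blast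
  next
    fix x assume "x \<in> orbit f (xs ! 0)"
    then show "x \<in> set xs"
      using assms(2) by (auto simp: orbit_altdef funpow_rotate1[OF assms])
  qed
qed

section \<open>Cycles on columns\<close>

text \<open>
  The cycle of \<open>R\<^bsub>a,b\<^esub>\<close> carried over from symbols to columns, where its order can be
  compared for different pairs of rows.
\<close>
definition column_cycle :: "(nat \<Rightarrow> nat \<Rightarrow> nat) \<Rightarrow> nat \<Rightarrow> nat \<Rightarrow> nat \<Rightarrow> nat list \<Rightarrow> bool" where
  "column_cycle R n a b xs \<longleftrightarrow>
     distinct xs \<and> set xs = {..<n} \<and> map (R b) xs = map (R a) (rotate1 xs)"

text \<open>A single list \<open>ps\<close> serves all pairs of rows, so marks can be allotted to a
  row independently of its partner. Since \<open>xs\<close> may start anywhere on its cycle,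
  \<open>subseq\<close> expresses cyclic order.\<close>

definition marked_rectangle :: "nat \<Rightarrow> nat \<Rightarrow> (nat \<Rightarrow> nat \<Rightarrow> nat) \<Rightarrow> nat list \<Rightarrow> bool" where
  "marked_rectangle m n R ps \<longleftrightarrow>
     (\<forall>a<m. bij_betw (R a) {..<n} {..<n}) \<and> distinct ps \<and> set ps \<subseteq> {..<n} \<and>
     (\<forall>a b. a < b \<longrightarrow> b < m \<longrightarrow> (\<exists>xs. column_cycle R n a b xs \<and> subseq ps xs))"

text \<open>Exchanging the rows inverts the permutation, so the cycle runs backwards. The rotation
  makes \<open>rotate1\<close> of the new list equal to \<open>rev xs\<close>.\<close>

lemma column_cycle_rev:
  assumes "column_cycle R n a b xs"
  shows "column_cycle R n b a (rev (rotate1 xs))"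
proof -
  have "rotate1 (rev (rotate1 xs)) = rev xs"
    by (cases xs) auto
  then show ?thesis
    using assms by (simp add: column_cycle_def flip: rev_map)
qed

lemma column_cycle_rotate:
  assumes "column_cycle R n a b (xs @ ys)"
  shows "column_cycle R n a b (ys @ xs)"
proof -
  have "ys @ xs = rotate (length xs) (xs @ ys)"
    by (simp add: rotate_append)
  then show ?thesis
    using assms by (simp add: column_cycle_def rotate1_rotate_swap flip: rotate_map)
qed

text \<open>Equal entries in a column would make it its own successor, which a single cycle of
  length at least 2 excludes.\<close>

lemma column_cycle_neq:
  assumes "column_cycle R n a b xs" "inj_on (R a) {..<n}" "2 \<le> n" "c < n"
  shows "R a c \<noteq> R b c"
proof -
  have xs: "distinct xs" "set xs = {..<n}" and eq: "map (R b) xs = map (R a) (rotate1 xs)"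
    using assms(1) by (auto simp: column_cycle_def)
  have len: "length xs = n"
    using distinct_card[OF xs(1)] xs(2) by simp
  obtain i where i: "i < n" "c = xs ! i"
    using assms(4) xs(2) len by (metis in_set_conv_nth lessThan_iff)
  have j: "Suc i mod n < n" "Suc i mod n \<noteq> i"
    using i(1) assms(3) by (auto simp: mod_Suc)
  have "R b c = R a (xs ! (Suc i mod n))"
    using i len eq nth_rotate1[of i xs] by (metis length_rotate1 nth_map)
  moreover have "xs ! (Suc i mod n) \<noteq> c"
    using j i len xs(1) by (simp add: nth_eq_iff_index_eq)
  moreover have "xs ! (Suc i mod n) < n"
    using j len xs(2) nth_mem[of "Suc i mod n" xs] by auto
  ultimately show ?thesis
    using assms(2,4) by (auto simp: inj_on_def)
qed

text \<open>The bijection \<open>R a\<close> turns the list of columns into a list of symbols that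
  \<open>row_perm\<close> shifts by one place.\<close>

lemma perfect_pair_column_cycle:
  assumes R: "latin_rectangle {..<n} m n R" "a < m" "b < m"
    and xs: "column_cycle R n a b xs"
  shows "perfect_pair {..<n} n R a b"
proof -
  let ?f = "row_perm {..<n} n R a b"
  have bij: "bij_betw (R a) {..<n} {..<n}" and "1 \<le> n"
    using R by (auto simp: latin_rectangle_def)
  have set: "set xs = {..<n}" and eq: "map (R b) xs = map (R a) (rotate1 xs)"
    using xs by (simp_all only: column_cycle_def)
  have "?f (R a c) = R b c" if "c \<in> set xs" for c
    using row_perm_eq_iff[OF R, of "R a c" "R b c"] bij_betwE[OF bij] that set by auto
  then have "map ?f (map (R a) xs) = map (R b) xs"
    by simp
  also have "\<dots> = rotate1 (map (R a) xs)"
    unfolding rotate1_map by (rule eq)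
  finally have "map ?f (map (R a) xs) = rotate1 (map (R a) xs)" .
  moreover have "0 \<in> set xs"
    unfolding set using \<open>1 \<le> n\<close> by simp
  then have "map (R a) xs \<noteq> []"
    by auto
  ultimately have "cyclic_on ?f (set (map (R a) xs))"
    by (rule cyclic_on_rotate1)
  then show ?thesis
    using set bij by (simp add: perfect_pair_def bij_betw_def)
qed

lemma marked_rectangle_perfect:
  assumes R: "marked_rectangle m n R ps" and "1 \<le> m" "m \<le> n" "2 \<le> n"
  shows "perfect_latin_rectangle {..<n} m n R"
proof -
  have bij: "bij_betw (R a) {..<n} {..<n}" if "a < m" for a
    using R that by (auto simp: marked_rectangle_def)
  have cyc: "\<exists>xs. column_cycle R n a b xs" if "a < m" "b < m" "a \<noteq> b" for a b
    using R that column_cycle_rev unfolding marked_rectangle_def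
    by (metis linorder_neq_iff)
  have "inj_on (\<lambda>a. R a c) {..<m}" if "c < n" for c
    using cyc column_cycle_neq bij that \<open>2 \<le> n\<close>
    by (intro inj_onI) (metis bij_betw_imp_inj_on lessThan_iff)
  then have latin: "latin_rectangle {..<n} m n R"
    using bij assms by (simp add: latin_rectangle_def)
  then show ?thesis
    using cyc perfect_pair_column_cycle unfolding perfect_latin_rectangle_def by blast
qed

section \<open>Adding two columns and two symbols\<close>

text \<open>Row \<open>a\<close> first gets the new symbols in the new columns, then swaps these
  with its marked columns. Written with transpositions, the row is visibly a bijection.\<close>

definition prolong :: "nat \<Rightarrow> (nat \<Rightarrow> nat \<Rightarrow> nat) \<Rightarrow> nat list \<Rightarrow> nat \<Rightarrow> nat \<Rightarrow> nat" where
  "prolong n R ps a = (\<lambda>c. if c < n then R a c else c) \<circ>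
     (transpose (ps ! (2 * a)) n \<circ> transpose (ps ! Suc (2 * a)) (Suc n))"

lemma bij_betw_prolong:
  assumes "bij_betw (R a) {..<n} {..<n}" "ps ! (2 * a) < n" "ps ! Suc (2 * a) < n"
  shows "bij_betw (prolong n R ps a) {..<Suc (Suc n)} {..<Suc (Suc n)}"
  unfolding prolong_def
proof (rule bij_betw_trans)
  show "bij_betw (transpose (ps ! (2 * a)) n \<circ> transpose (ps ! Suc (2 * a)) (Suc n))
      {..<Suc (Suc n)} {..<Suc (Suc n)}"
    using assms(2,3)
    by (intro permutes_imp_bij permutes_compose permutes_swap_id) auto
  have "bij_betw (\<lambda>c. if c < n then R a c else c) {..<n} {..<n}"
    using assms(1) by (rule bij_betw_cong[THEN iffD1, rotated]) simp
  moreover have "bij_betw (\<lambda>c. if c < n then R a c else c) {n, Suc n} {n, Suc n}"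
    by (rule bij_betw_cong[THEN iffD1, OF _ bij_betw_id]) auto
  ultimately have "bij_betw (\<lambda>c. if c < n then R a c else c)
      ({..<n} \<union> {n, Suc n}) ({..<n} \<union> {n, Suc n})"
    by (rule bij_betw_combine) auto
  moreover have "{..<n} \<union> {n, Suc n} = {..<Suc (Suc n)}"
    by auto
  ultimately show "bij_betw (\<lambda>c. if c < n then R a c else c)
      {..<Suc (Suc n)} {..<Suc (Suc n)}"
    by simp
qed

lemma prolong_simps:
  assumes "ps ! (2 * a) = x" "ps ! Suc (2 * a) = y" "x < n" "y < n" "x \<noteq> y"
  shows "prolong n R ps a x = n" "prolong n R ps a y = Suc n"
    "prolong n R ps a n = R a x" "prolong n R ps a (Suc n) = R a y"
    "c < n \<Longrightarrow> c \<noteq> x \<Longrightarrow> c \<noteq> y \<Longrightarrow> prolong n R ps a c = R a c"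
  using assms by (auto simp: prolong_def transpose_def)

text \<open>Row \<open>a\<close> now holds its old entries of \<open>xa\<close>, \<open>ya\<close>
  in columns \<open>n\<close>, \<open>Suc n\<close>, so \<open>A\<close> leads to
  \<open>Suc n\<close> and \<open>D\<close> to \<open>n\<close>. Row \<open>b\<close> continues from
  there as it did from \<open>yb\<close> and \<open>xb\<close>, into \<open>D\<close> and
  \<open>C\<close>. The new symbols link \<open>xb\<close> to \<open>xa\<close> and
  \<open>yb\<close> to \<open>ya\<close>. The block \<open>D\<close> survives intact, and with it
  the order of later marks.\<close>

lemma column_cycle_prolong:
  assumes cyc: "column_cycle R n a b (xa # A @ ya # B @ xb # C @ yb # D)"
    and marks: "ps ! (2 * a) = xa" "ps ! Suc (2 * a) = ya" "ps ! (2 * b) = xb" "ps ! Suc (2 * b) = yb"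
  shows "column_cycle (prolong n R ps) (Suc (Suc n)) a b
    (xa # A @ Suc n # D @ n # C @ yb # ya # B @ [xb])"
proof -
  let ?Q = "prolong n R ps"
  let ?xs = "xa # A @ ya # B @ xb # C @ yb # D"
  have dist: "distinct ?xs" and set: "set ?xs = {..<n}"
    and eq: "map (R b) ?xs = map (R a) (rotate1 ?xs)"
    using cyc by (auto simp only: column_cycle_def)
  have lt: "xa < n" "ya < n" "xb < n" "yb < n" "\<forall>c\<in>set A \<union> set B \<union> set C \<union> set D. c < n"
    using set by auto
  have split: "us = us' \<and> vs = vs'" if "us @ vs = us' @ vs'" "length us = length us'"
    for us vs us' vs' :: "nat list"
    using that by simp
  have len: "length (map (R b) (x # X)) = length (map (R a) (X @ [y]))" for x X y
    by simp
  \<comment> \<open>The cycle equation is cut before each mark; equal lengths then allow the four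
    segments to be compared separately.\<close>
  have s0: "map (R b) (xa # A) @ map (R b) (ya # B) @ map (R b) (xb # C) @ map (R b) (yb # D) =
      map (R a) (A @ [ya]) @ map (R a) (B @ [xb]) @ map (R a) (C @ [yb]) @ map (R a) (D @ [xa])"
    using eq by simp
  note s1 = split[OF s0 len]
  note s2 = split[OF conjunct2[OF s1] len]
  note s3 = split[OF conjunct2[OF s2] len]
  note segs = conjunct1[OF s1] conjunct1[OF s2] s3
  have neq: "xa \<noteq> ya" "xb \<noteq> yb" "xa \<noteq> xb" "xa \<noteq> yb" "ya \<noteq> xb" "ya \<noteq> yb"
    using dist by auto
  note qa = prolong_simps[OF marks(1,2) lt(1,2) neq(1), where R = R]
  note qb = prolong_simps[OF marks(3,4) lt(3,4) neq(2), where R = R]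
  have same_rows: "map (?Q a) X = map (R a) X \<and> map (?Q b) X = map (R b) X"
    if "set X \<subseteq> set A \<union> set B \<union> set C \<union> set D" for X
  proof -
    have "c < n \<and> c \<noteq> xa \<and> c \<noteq> ya \<and> c \<noteq> xb \<and> c \<noteq> yb" if "c \<in> set A \<union> set B \<union> set C \<union> set D" for c
      using that dist lt(5) by auto
    then show ?thesis
      using that qa(5) qb(5) by (simp add: subset_iff)
  qed
  have same: "map (?Q r) X = map (R r) X" if "r = a \<or> r = b" "X = A \<or> X = B \<or> X = C \<or> X = D" for r X
    using that same_rows[of X] by auto
  have ends: "?Q b xa = R b xa" "?Q b ya = R b ya" "?Q a xb = R a xb" "?Q a yb = R a yb"
    using neq lt by (auto intro!: qa(5) qb(5))
  have segs': "map (?Q b) (xa # A) = map (?Q a) (A @ [Suc n])"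
    "map (?Q b) (Suc n # D) = map (?Q a) (D @ [n])"
    "map (?Q b) (n # C) = map (?Q a) (C @ [yb])"
    "map (?Q b) [yb] = map (?Q a) [ya]"
    "map (?Q b) (ya # B) = map (?Q a) (B @ [xb])"
    "map (?Q b) [xb] = map (?Q a) [xa]"
    using segs by (simp_all add: same ends qa(1-4) qb(1-4) del: map_eq_conv)
  let ?ys = "xa # A @ Suc n # D @ n # C @ yb # ya # B @ [xb]"
  have "map (?Q b) ?ys = map (?Q b) (xa # A) @ map (?Q b) (Suc n # D) @ map (?Q b) (n # C) @
      map (?Q b) [yb] @ map (?Q b) (ya # B) @ map (?Q b) [xb]"
    by simp
  also have "\<dots> = map (?Q a) (rotate1 ?ys)"
    unfolding segs' by simp
  finally have "map (?Q b) ?ys = map (?Q a) (rotate1 ?ys)" .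
  moreover have "distinct ?ys"
  proof -
    have "n \<notin> set ?xs" "Suc n \<notin> set ?xs"
      unfolding set by simp_all
    then have "distinct (n # Suc n # ?xs)"
      using dist by simp
    \<comment> \<open>The new cycle only rearranges the old columns and the two new ones.\<close>
    moreover have "mset ?ys = mset (n # Suc n # ?xs)"
      by simp
    ultimately show ?thesis
      using mset_eq_imp_distinct_iff by blast
  qed
  moreover have "set ?ys = {..<Suc (Suc n)}"
  proof -
    have "set ?ys = set ?xs \<union> {n, Suc n}"
      by auto
    also have "\<dots> = {..<Suc (Suc n)}"
      unfolding set by auto
    finally show ?thesis .
  qed
  ultimately show ?thesis
    by (simp only: column_cycle_def)
qed

lemma subseq_drop_mono:
  assumes "i \<le> j" "subseq (drop i ps) xs"
  shows "subseq (drop j ps) xs"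
  using assms suffix_imp_subseq[OF suffix_drop, of "j - i" "drop i ps"]
  by (simp add: subseq_order.trans)

lemma subseq_drop_split:
  assumes "subseq (drop i ps) xs" "i < length ps"
  obtains us vs where "xs = us @ ps ! i # vs" "subseq (drop (Suc i) ps) vs"
proof -
  have "subseq (ps ! i # drop (Suc i) ps) xs"
    using assms by (simp add: Cons_nth_drop_Suc)
  then show ?thesis
    using that by (auto dest!: list_emb_ConsD)
qed

lemma marked_rectangle_prolong:
  assumes R: "marked_rectangle m n R ps" and len: "2 * m \<le> length ps"
  shows "marked_rectangle m (Suc (Suc n)) (prolong n R ps) (drop (2 * m) ps)"
proof -
  let ?Q = "prolong n R ps"
  have dist: "distinct ps" and sub: "set ps \<subseteq> {..<n}"
    using R by (auto simp: marked_rectangle_def)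
  have "bij_betw (?Q a) {..<Suc (Suc n)} {..<Suc (Suc n)}" if "a < m" for a
  proof (rule bij_betw_prolong)
    show "bij_betw (R a) {..<n} {..<n}"
      using R that by (auto simp: marked_rectangle_def)
    show "ps ! (2 * a) < n" "ps ! Suc (2 * a) < n"
      using sub len that by (auto intro!: subsetD[OF sub, simplified] nth_mem)
  qed
  moreover have "\<exists>ys. column_cycle ?Q (Suc (Suc n)) a b ys \<and> subseq (drop (2 * m) ps) ys"
    if ab: "a < b" "b < m" for a b
  proof -
    obtain xs where xs: "column_cycle R n a b xs" "subseq ps xs"
      using R ab unfolding marked_rectangle_def by blast
    \<comment> \<open>The cycle is split in turn at the marks of \<open>a\<close> and of
      \<open>b\<close>. As \<open>a < b < m\<close>, the marks from index \<open>2 * m\<close> on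
      all lie in the last piece \<open>D\<close>.\<close>
    have "subseq (drop (2 * a) ps) xs"
      using subseq_drop_mono[of 0 "2 * a" ps xs] xs(2) by simp
    then obtain E xs1 where 1: "xs = E @ ps ! (2 * a) # xs1" "subseq (drop (Suc (2 * a)) ps) xs1"
      using subseq_drop_split ab len by (metis Suc_1 less_le_trans less_trans mult_less_mono2 zero_less_Suc)
    have "Suc (2 * a) < length ps"
      using ab len by linarith
    then obtain A xs2 where 2: "xs1 = A @ ps ! Suc (2 * a) # xs2" "subseq (drop (Suc (Suc (2 * a))) ps) xs2"
      using subseq_drop_split[OF 1(2)] by blast
    have "subseq (drop (2 * b) ps) xs2"
      using subseq_drop_mono[OF _ 2(2)] ab by simp
    moreover have "2 * b < length ps"
      using ab len by linarith
    ultimately obtain B xs3 where 3: "xs2 = B @ ps ! (2 * b) # xs3" "subseq (drop (Suc (2 * b)) ps) xs3"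
      using subseq_drop_split by blast
    have "Suc (2 * b) < length ps"
      using ab len by linarith
    then obtain C D where 4: "xs3 = C @ ps ! Suc (2 * b) # D" "subseq (drop (Suc (Suc (2 * b))) ps) D"
      using subseq_drop_split[OF 3(2)] by blast
    have D: "subseq (drop (2 * m) ps) D"
      using subseq_drop_mono[OF _ 4(2)] ab by simp
    \<comment> \<open>Rotating the initial piece \<open>E\<close> to the end lets
      \<open>D @ E\<close> act as the final block.\<close>
    have "column_cycle R n a b ((ps ! (2 * a) # A @ ps ! Suc (2 * a) # B @ ps ! (2 * b) # C @
        ps ! Suc (2 * b) # D) @ E)"
      using xs(1) unfolding 1(1) 2(1) 3(1) 4(1) by (rule column_cycle_rotate)
    then have "column_cycle R n a b (ps ! (2 * a) # A @ ps ! Suc (2 * a) # B @ ps ! (2 * b) # C @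
        ps ! Suc (2 * b) # (D @ E))"
      by simp
    from column_cycle_prolong[OF this refl refl refl refl]
    have "column_cycle ?Q (Suc (Suc n)) a b (ps ! (2 * a) # A @ Suc n # (D @ E) @ n # C @
        ps ! Suc (2 * b) # ps ! Suc (2 * a) # B @ [ps ! (2 * b)])" .
    moreover have "subseq (drop (2 * m) ps) ((ps ! (2 * a) # A @ [Suc n]) @ D @ E @ n # C @
        ps ! Suc (2 * b) # ps ! Suc (2 * a) # B @ [ps ! (2 * b)])"
      by (intro subseq_drop_many subseq_rev_drop_many D)
    ultimately show ?thesis
      by (intro exI conjI) (assumption, simp)
  qed
  moreover have "set (drop (2 * m) ps) \<subseteq> {..<Suc (Suc n)}"
    using sub set_drop_subset[of "2 * m" ps] by fastforce
  ultimately show ?thesis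
    using dist by (simp add: marked_rectangle_def)
qed

text \<open>Each prolongation uses up \<open>2 * m\<close> marks and adds two columns.\<close>

lemma marked_rectangle_prolong_iterate:
  assumes "marked_rectangle m n R ps" "2 * m * k \<le> length ps"
  shows "\<exists>R' ps'. marked_rectangle m (n + 2 * k) R' ps'"
  using assms
proof (induction k arbitrary: n R ps)
  case 0
  then show ?case by auto
next
  case (Suc k)
  have "marked_rectangle m (Suc (Suc n)) (prolong n R ps) (drop (2 * m) ps)"
    using Suc.prems by (intro marked_rectangle_prolong) auto
  moreover have "2 * m * k \<le> length (drop (2 * m) ps)"
    using Suc.prems(2) by simp
  ultimately show ?case
    using Suc.IH[of "Suc (Suc n)"] by simp
qed

section \<open>The cyclic rectangle\<close>

lemma subseq_multiples_upt:
  assumes "l * k \<le> n" "0 < k"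
  shows "subseq (map (\<lambda>j. j * k) [0..<l]) [0..<n]"
  using assms(1)
proof (induction l arbitrary: n)
  case (Suc l)
  have "subseq (map (\<lambda>j. j * k) [0..<l] @ [l * k]) ([0..<l * k] @ [l * k..<n])"
    using Suc assms(2) by (intro list_emb_append_mono) (auto simp: subseq_singleton_left)
  moreover have "[0..<l * k] @ [l * k..<n] = [0..<n]"
    using Suc.prems upt_add_eq_append[of 0 "l * k" "n - l * k"] by simp
  ultimately show ?case
    by simp
qed simp

lemma inj_on_mult_mod:
  fixes d n :: nat
  assumes "coprime d n"
  shows "inj_on (\<lambda>i. i * d mod n) {..<n}"
proof (rule inj_onI)
  fix i j assume "i \<in> {..<n}" "j \<in> {..<n}" "i * d mod n = j * d mod n"
  then have "[i * d = j * d] (mod n)"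
    by (simp add: cong_def)
  then have "[i = j] (mod n)"
    using assms by (simp add: cong_mult_rcancel_nat)
  then show "i = j"
    using \<open>i \<in> {..<n}\<close> \<open>j \<in> {..<n}\<close> by (simp add: cong_def)
qed

lemma marked_rectangle_cyclic:
  assumes M: "0 < M" "\<And>d. 0 < d \<Longrightarrow> d < m \<Longrightarrow> d dvd M"
    and "coprime M n" "0 < n" "l * M \<le> n"
  shows "marked_rectangle m n (\<lambda>a c. (c + a) mod n) (map (\<lambda>j. j * M) [0..<l])"
proof -
  have "inj_on (\<lambda>c. (c + a) mod n) {..<n}" for a
  proof (rule inj_onI)
    fix i j assume "i \<in> {..<n}" "j \<in> {..<n}" "(i + a) mod n = (j + a) mod n"
    then have "[i + a = j + a] (mod n)"
      by (simp add: cong_def)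
    then have "[i = j] (mod n)"
      by (simp add: cong_add_rcancel_nat)
    then show "i = j"
      using \<open>i \<in> {..<n}\<close> \<open>j \<in> {..<n}\<close> by (simp add: cong_def)
  qed
  then have "bij_betw (\<lambda>c. (c + a) mod n) {..<n} {..<n}" for a
    using \<open>0 < n\<close> by (intro bij_betw_imageI endo_inj_surj) auto
  moreover have "\<exists>xs. column_cycle (\<lambda>a c. (c + a) mod n) n a b xs \<and>
      subseq (map (\<lambda>j. j * M) [0..<l]) xs" if ab: "a < b" "b < m" for a b
  proof -
    define d where "d = b - a"
    \<comment> \<open>Moving from row \<open>a\<close> to row \<open>b\<close> adds \<open>d\<close>
      to the symbol, so the next column is \<open>d\<close> further on modulo
      \<open>n\<close>.\<close>
    define xs where "xs = map (\<lambda>i. i * d mod n) [0..<n]"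
    have d: "0 < d" "d dvd M" "b = a + d"
      using ab M(2)[of d] by (auto simp: d_def)
    have inj: "inj_on (\<lambda>i. i * d mod n) {..<n}"
      using d(2) \<open>coprime M n\<close> by (intro inj_on_mult_mod) (meson coprime_divisors dvd_refl)
    have "distinct xs"
      using inj by (simp add: xs_def distinct_map atLeast0LessThan)
    moreover have "set xs = {..<n}"
      unfolding xs_def set_map set_upt atLeast0LessThan
      using inj \<open>0 < n\<close> by (intro endo_inj_surj) auto
    moreover have "map (\<lambda>c. (c + b) mod n) xs = map (\<lambda>c. (c + a) mod n) (rotate1 xs)"
    proof (rule nth_equalityI)
      fix i assume "i < length (map (\<lambda>c. (c + b) mod n) xs)"
      then have i: "i < n"
        by (simp add: xs_def)
      then have "rotate1 xs ! i = (Suc i mod n) * d mod n"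
        using nth_rotate1[of i xs] by (simp add: xs_def)
      also have "\<dots> = (i * d + d) mod n"
        by (simp add: mod_mult_left_eq add.commute)
      finally have "(rotate1 xs ! i + a) mod n = (i * d + d + a) mod n"
        by (simp add: mod_add_left_eq)
      moreover have "(xs ! i + b) mod n = (i * d + d + a) mod n"
        using i mod_add_left_eq[of "i * d" n b] by (simp add: xs_def) (simp add: d(3) ac_simps)
      moreover have "length xs = n"
        by (simp add: xs_def)
      ultimately show "map (\<lambda>c. (c + b) mod n) xs ! i = map (\<lambda>c. (c + a) mod n) (rotate1 xs) ! i"
        using i by (simp only: nth_map length_rotate1)
    qed simp
    moreover have "subseq (map (\<lambda>j. j * M) [0..<l]) xs"
    proof -
      \<comment> \<open>The mark \<open>j * M\<close> is \<open>j * k\<close> steps from column 0.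
        It is below \<open>n\<close>, so it is reached before any reduction modulo \<open>n\<close>,
        whatever \<open>d\<close> is.\<close>
      obtain k where k: "M = k * d"
        using d(2) by (auto simp: dvd_def mult.commute)
      have "0 < k"
        using k M(1) by simp
      have "l * k \<le> l * M"
        using k d(1) by simp
      then have "l * k \<le> n"
        using \<open>l * M \<le> n\<close> by (rule le_trans)
      then have "subseq (map (\<lambda>i. i * d mod n) (map (\<lambda>j. j * k) [0..<l])) xs"
        unfolding xs_def by (intro subseq_map subseq_multiples_upt \<open>0 < k\<close>)
      moreover have "j * M < n" if "j < l" for j
        using that M(1) \<open>l * M \<le> n\<close> by (meson less_le_trans mult_less_mono1)
      then have "map (\<lambda>i. i * d mod n) (map (\<lambda>j. j * k) [0..<l]) = map (\<lambda>j. j * M) [0..<l]"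
        by (auto simp: k mult.assoc)
      ultimately show ?thesis
        by (simp only:)
    qed
    ultimately show ?thesis
      by (auto simp: column_cycle_def)
  qed
  moreover have "j * M < n" if "j < l" for j
    using that M(1) \<open>l * M \<le> n\<close> by (meson less_le_trans mult_less_mono1)
  ultimately show ?thesis
    using M(1) by (auto simp: marked_rectangle_def distinct_map inj_on_def)
qed

section \<open>Choice of the parameters\<close>

theorem theorem1:
  fixes m :: nat
  assumes "m \<ge> 1"
  shows "\<exists>n0::nat. \<forall>n::nat. n \<ge> n0 \<longrightarrow> odd n \<longrightarrow>
    (\<exists>(S :: nat set) R. perfect_latin_rectangle S m n R)"
proof -
  \<comment> \<open>The factorial supplies the divisibility by all row differences; the factor 2
    keeps \<open>(n - 1) mod M\<close> even also for \<open>m = 1\<close>.\<close>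
  define M :: nat where "M = 2 * fact m"
  have M: "0 < M" "even M"
    by (auto simp: M_def)
  have dvd: "d dvd M" if "0 < d" "d < m" for d
    using that by (auto simp: M_def intro!: dvd_mult dvd_fact)
  show ?thesis
  proof (rule exI, intro allI impI)
    fix n :: nat
    \<comment> \<open>The first summand makes room for \<open>2 * m * k\<close> marks at spacing
      \<open>M\<close>, the second covers the loss of \<open>2 * k\<close> columns, and the rest
      ensures \<open>m \<le> n\<close> and \<open>2 \<le> n\<close>.\<close>
    assume n: "n \<ge> 2 * m * M * M + M + m + 2" and "odd n"
    define k where "k = (n - 1) mod M div 2"
    have "even ((n - 1) mod M)"
      using \<open>odd n\<close> M(2) by (simp add: dvd_mod_iff)
    then have k: "2 * k = (n - 1) mod M"
      by (simp add: k_def)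
    then have "2 * k < M"
      using M(1) by simp
    define N where "N = n - 2 * k"
    have N: "n = N + 2 * k" "0 < N" "2 * m * M * M \<le> N"
      using n \<open>2 * k < M\<close> by (auto simp: N_def)
    \<comment> \<open>Removing the remainder \<open>2 * k\<close> leaves \<open>N\<close> congruent
      to 1 modulo \<open>M\<close>, hence coprime to \<open>M\<close>.\<close>
    have "N - 1 = (n - 1) div M * M"
      using k minus_mod_eq_div_mult[of "n - 1" M] by (simp add: N_def)
    then have "N = (n - 1) div M * M + 1"
      using N(2) by linarith
    then have "coprime M N"
      by (metis coprime_1_right coprime_iff_gcd_eq_1 gcd_add_mult)
    have "2 * m * k * M \<le> 2 * m * M * M"
      using \<open>2 * k < M\<close> by (intro mult_le_mono) auto
    then have "2 * m * k * M \<le> N"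
      using N(3) by linarith
    then have "marked_rectangle m N (\<lambda>a c. (c + a) mod N) (map (\<lambda>j. j * M) [0..<2 * m * k])"
      using M(1) dvd \<open>coprime M N\<close> N(2) by (intro marked_rectangle_cyclic) auto
    from marked_rectangle_prolong_iterate[OF this, of k]
    obtain R ps where "marked_rectangle m n R ps"
      using N(1) by auto
    then have "perfect_latin_rectangle {..<n} m n R"
      using n assms by (intro marked_rectangle_perfect) auto
    then show "\<exists>(S :: nat set) R. perfect_latin_rectangle S m n R"
      by blast
  qed
qed

end
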